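(* Assume that the generalized Saunders--Simon--Yip (gSSY) tridiagonalization process, applied to $\mathbf{M}, \mathbf{N}, \mathbf{A}$ with the initial vectors $\mathbf{b}$ and $\mathbf{c}$ replaced by $\mathbf{P}\mathbf{b}$ and $\mathbf{Q}^\top\mathbf{c}$, does not terminate at the first $k$ iterations. Then the generated matrices $\mathbf{U}_{k+1} = \begin{bmatrix}\mathbf{u}_1 & \cdots & \mathbf{u}_{k+1}\end{bmatrix}$ and $\mathbf{V}_{k+1} = \begin{bmatrix}\mathbf{v}_1 & \cdots & \mathbf{v}_{k+1}\end{bmatrix}$ satisfy $$\mathrm{range}(\mathbf{U}_{k+1}) \subseteq \mathbf{M}^{-1}\, \mathrm{range}(\mathbf{P}), \qquad \mathrm{range}(\mathbf{V}_{k+1}) \subseteq \mathbf{N}^{-1}\, \mathrm{range}(\mathbf{Q}^\top).$$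
   Context: All matrices and vectors are real. Let $\mathbf{M} \in \mathbb{R}^{m \times m}$ and $\mathbf{N} \in \mathbb{R}^{n \times n}$ be symmetric positive definite, $\mathbf{A} \in \mathbb{R}^{m\times n}$ nonzero, $\mathbf{b} \in \mathbb{R}^m$ and $\mathbf{c} \in \mathbb{R}^n$ nonzero. For a matrix $\mathbf{B}$ and a subspace $S$, $\mathbf{B}S = \{\mathbf{B}\mathbf{s} : \mathbf{s}\in S\}$. Elliptic singular value decomposition (ESVD) of $\mathbf{A}$: $\mathbf{A} = \mathbf{M} \widetilde{\mathbf{U}} \boldsymbol{\Sigma} \widetilde{\mathbf{V}}^\top \mathbf{N}$, where $\widetilde{\mathbf{U}} \in \mathbb{R}^{m \times m}$ and $\widetilde{\mathbf{V}} \in \mathbb{R}^{n \times n}$ satisfy $\widetilde{\mathbf{U}}^\top \mathbf{M} \widetilde{\mathbf{U}} = \mathbf{I}_m$ and $\widetilde{\mathbf{V}}^\top \mathbf{N} \widetilde{\mathbf{V}} = \mathbf{I}_n$, and $\boldsymbol{\Sigma} \in \mathbb{R}^{m \times n}$ is diagonal with nonnegative diagonal entries in nonincreasing order. Fix such an ESVD and an integer $\ell$ with $1 \le \ell \le \min\{m,n\}$ (the number of deflated triplets). Let $\widetilde{\mathbf{U}}_\ell$ and $\widetilde{\mathbf{V}}_\ell$ be the matrices consisting of the first $\ell$ columns of $\widetilde{\mathbf{U}}$ and $\widetilde{\mathbf{V}}$, and define $$\mathbf{P} = \mathbf{I} - \mathbf{M} \widetilde{\mathbf{U}}_\ell \widetilde{\mathbf{U}}_\ell^\top,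 \qquad \mathbf{Q} = \mathbf{I} - \widetilde{\mathbf{V}}_\ell \widetilde{\mathbf{V}}_\ell^\top \mathbf{N}.$$ gSSY tridiagonalization process with input $\{\mathbf{M},\mathbf{N},\mathbf{A},\mathbf{b}',\mathbf{c}'\}$, where $\mathbf{b}' \in \mathbb{R}^m$, $\mathbf{c}'\in\mathbb{R}^n$ (here $\mathbf{b}'=\mathbf{P}\mathbf{b}$, $\mathbf{c}'=\mathbf{Q}^\top\mathbf{c}$): a normalization written $\beta \mathbf{M}\mathbf{u} = \mathbf{w}$ means: $\widetilde{\mathbf{w}} = \mathbf{M}^{-1}\mathbf{w}$, $\beta = \sqrt{\widetilde{\mathbf{w}}^\top \mathbf{w}}$; if $\beta = 0$ then the process terminates, else $\mathbf{u} = \widetilde{\mathbf{w}}/\beta$ (and similarly with $\mathbf{N}$). Set $\mathbf{u}_0 = \mathbf{0}$, $\mathbf{v}_0 = \mathbf{0}$, $\beta_1 \mathbf{M}\mathbf{u}_1 = \mathbf{b}'$, $\gamma_1 \mathbf{N}\mathbf{v}_1 = \mathbf{c}'$. For $j = 1, 2, \dots$: $$\mathbf{q} = \mathbf{A}\mathbf{v}_j - \gamma_j \mathbf{M}\mathbf{u}_{j-1}, \quad \mathbf{p} = \mathbf{A}^\top \mathbf{u}_j - \beta_j \mathbf{N}\mathbf{v}_{j-1}, \quad \alpha_j = \mathbf{u}_j^\top \mathbf{q},$$ $$\beta_{j+1}\mathbf{M}\mathbf{u}_{j+1} = \mathbf{q} - \alpha_j \mathbf{M}\mathbf{u}_j,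 \quad \gamma_{j+1}\mathbf{N}\mathbf{v}_{j+1} = \mathbf{p} - \alpha_j \mathbf{N}\mathbf{v}_j.$$ Not terminating at the first $k$ iterations means that $\beta_1,\dots,\beta_{k+1}$ and $\gamma_1,\dots,\gamma_{k+1}$ are all nonzero, so that $\mathbf{u}_1,\dots,\mathbf{u}_{k+1}$ and $\mathbf{v}_1,\dots,\mathbf{v}_{k+1}$ are all defined. *)

theory Defs
  imports
    Complex_Main
    "Jordan_Normal_Form.Gauss_Jordan_Elimination"
    "Jordan_Normal_Form.VS_Connect"
begin

definition spd_mat :: "nat \<Rightarrow> real mat \<Rightarrow> bool" where
  "spd_mat n M \<longleftrightarrow>
     M \<in> carrier_mat n n \<and>
     transpose_mat M = M \<and>
     (\<forall>x \<in> carrier_vec n. x \<noteq> 0\<^sub>v n \<longrightarrow> x \<bullet> (M *\<^sub>v x) > 0)"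

(* Meaningful only for invertible matrices; it is applied to positive definite ones. *)
abbreviation mat_inv :: "real mat \<Rightarrow> real mat" where
  "mat_inv M \<equiv> the (mat_inverse M)"

definition is_esvd ::
  "nat \<Rightarrow> nat \<Rightarrow> real mat \<Rightarrow> real mat \<Rightarrow> real mat \<Rightarrow> real mat \<Rightarrow> real mat \<Rightarrow> real mat \<Rightarrow> bool"
where
  "is_esvd m n M N A U S V \<longleftrightarrow>
     U \<in> carrier_mat m m \<and> S \<in> carrier_mat m n \<and> V \<in> carrier_mat n n \<and>
     A = M * U * S * transpose_mat V * N \<and>
     transpose_mat U * M * U = 1\<^sub>m m \<and>
     transpose_mat V * N * V = 1\<^sub>m n \<and>
     diagonal_mat S \<and>
     (\<forall>i < min m n. S $$ (i, i) \<ge> 0) \<and>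
     (\<forall>i j. i \<le> j \<longrightarrow> j < min m n \<longrightarrow> S $$ (j, j) \<le> S $$ (i, i))"

definition first_cols :: "nat \<Rightarrow> real mat \<Rightarrow> real mat" where
  "first_cols l U = mat_of_cols (dim_row U) (take l (cols U))"

definition deflation_P :: "real mat \<Rightarrow> real mat \<Rightarrow> nat \<Rightarrow> real mat" where
  "deflation_P M U l =
     1\<^sub>m (dim_row M) - M * first_cols l U * transpose_mat (first_cols l U)"

definition deflation_Q :: "real mat \<Rightarrow> real mat \<Rightarrow> nat \<Rightarrow> real mat" where
  "deflation_Q N V l =
     1\<^sub>m (dim_row N) - first_cols l V * transpose_mat (first_cols l V) * N"

(* The step written "beta M u = w": returns (beta, u), or None if the process terminates here. *)
definition elliptic_normalize :: "real mat \<Rightarrow> real vec \<Rightarrow> (real \<times> real vec) option" where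
  "elliptic_normalize M w =
     (let w' = mat_inv M *\<^sub>v w;
          \<beta> = sqrt (w' \<bullet> w)
      in if \<beta> = 0 then None else Some (\<beta>, (1 / \<beta>) \<cdot>\<^sub>v w'))"

(* The data entering iteration j (j = 1, 2, ...):
   beta_j, u_(j-1), u_j, gamma_j, v_(j-1), v_j. *)
record gssy_state =
  beta :: real
  u_prev :: "real vec"
  u_cur :: "real vec"
  gamma :: real
  v_prev :: "real vec"
  v_cur :: "real vec"

definition gssy_init ::
  "real mat \<Rightarrow> real mat \<Rightarrow> real vec \<Rightarrow> real vec \<Rightarrow> gssy_state option"
where
  "gssy_init M N b c =
     (case (elliptic_normalize M b, elliptic_normalize N c) of
        (Some (\<beta>, u), Some (\<gamma>, v)) \<Rightarrow>
          Some \<lparr>beta = \<beta>, u_prev = 0\<^sub>v (dim_row M), u_cur = u,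
                gamma = \<gamma>, v_prev = 0\<^sub>v (dim_row N), v_cur = v\<rparr>
      | _ \<Rightarrow> None)"

definition gssy_step ::
  "real mat \<Rightarrow> real mat \<Rightarrow> real mat \<Rightarrow> gssy_state \<Rightarrow> gssy_state option"
where
  "gssy_step M N A s =
     (let q = A *\<^sub>v v_cur s - gamma s \<cdot>\<^sub>v (M *\<^sub>v u_prev s);
          p = transpose_mat A *\<^sub>v u_cur s - beta s \<cdot>\<^sub>v (N *\<^sub>v v_prev s);
          \<alpha> = u_cur s \<bullet> q
      in case (elliptic_normalize M (q - \<alpha> \<cdot>\<^sub>v (M *\<^sub>v u_cur s)),
               elliptic_normalize N (p - \<alpha> \<cdot>\<^sub>v (N *\<^sub>v v_cur s))) of
           (Some (\<beta>, u), Some (\<gamma>, v)) \<Rightarrow>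
             Some \<lparr>beta = \<beta>, u_prev = u_cur s, u_cur = u,
                   gamma = \<gamma>, v_prev = v_cur s, v_cur = v\<rparr>
         | _ \<Rightarrow> None)"

(* The state after k iterations, i.e. the one whose current vectors are u_(k+1) and v_(k+1).
   It is None as soon as one of beta_1, ..., beta_(k+1), gamma_1, ..., gamma_(k+1) vanishes. *)
primrec gssy ::
  "real mat \<Rightarrow> real mat \<Rightarrow> real mat \<Rightarrow> real vec \<Rightarrow> real vec \<Rightarrow> nat \<Rightarrow> gssy_state option"
where
  "gssy M N A b c 0 = gssy_init M N b c"
| "gssy M N A b c (Suc k) = Option.bind (gssy M N A b c k) (gssy_step M N A)"

(* The matrices with columns u_1, ..., u_j and v_1, ..., v_j;
   meaningful only if gssy has not terminated within j - 1 iterations. *)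
definition gssy_U ::
  "real mat \<Rightarrow> real mat \<Rightarrow> real mat \<Rightarrow> real vec \<Rightarrow> real vec \<Rightarrow> nat \<Rightarrow> real mat"
where
  "gssy_U M N A b c j =
     mat_of_cols (dim_row M) (map (\<lambda>i. u_cur (the (gssy M N A b c i))) [0..<j])"

definition gssy_V ::
  "real mat \<Rightarrow> real mat \<Rightarrow> real mat \<Rightarrow> real vec \<Rightarrow> real vec \<Rightarrow> nat \<Rightarrow> real mat"
where
  "gssy_V M N A b c j =
     mat_of_cols (dim_row N) (map (\<lambda>i. v_cur (the (gssy M N A b c i))) [0..<j])"

end

theory Submission
  imports Defs
begin

text \<open>
  Let \<open>W\<^sub>U\<close> be the space of vectors orthogonal to the first \<open>l\<close> columns of \<open>U\<close>, and define \<open>W\<^sub>V\<close>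
  in the same way. As \<open>U\<close> is \<open>M\<close>-orthonormal, \<open>W\<^sub>U\<close> is the range of the oblique projector \<open>P\<close>;
  likewise \<open>W\<^sub>V\<close> is the range of the transpose of \<open>Q\<close>, which is the same projector for \<open>N\<close> and \<open>V\<close>.
  Since \<open>S\<close> is diagonal, the ESVD shows that \<open>N v \<in> W\<^sub>V\<close> implies \<open>A v \<in> W\<^sub>U\<close>, and symmetrically
  for the transpose of \<open>A\<close>. Hence the recurrence keeps all \<open>M u\<^sub>j\<close> in \<open>W\<^sub>U\<close> and all \<open>N v\<^sub>j\<close> in \<open>W\<^sub>V\<close>.
\<close>

section \<open>Vectors orthogonal to the first \<open>l\<close> columns\<close>

lemma first_cols_carrier:
  assumes "U \<in> carrier_mat m m" and "l \<le> m"
  shows "first_cols l U \<in> carrier_mat m l"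
  using assms mat_of_cols_carrier(1)[of m "take l (cols U)"] by (simp add: first_cols_def)

lemma col_first_cols:
  assumes "U \<in> carrier_mat m m" and "l \<le> m" and "i < l"
  shows "col (first_cols l U) i = col U i"
  using assms col_dim[of U i] by (simp add: first_cols_def)

text \<open>Encoded as a kernel rather than as the range of a projector: closure under linear
  operations is then immediate, and membership can be tested column by column.\<close>

definition deflated :: "nat \<Rightarrow> real mat \<Rightarrow> nat \<Rightarrow> real vec set" where
  "deflated m U l = {x \<in> carrier_vec m. transpose_mat (first_cols l U) *\<^sub>v x = 0\<^sub>v l}"

lemma deflated_iff:
  assumes "U \<in> carrier_mat m m" and "l \<le> m"
  shows "x \<in> deflated m U l \<longleftrightarrow> x \<in> carrier_vec m \<and> (\<forall>i<l. col U i \<bullet> x = 0)"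
proof -
  note F = first_cols_carrier[OF assms]
  have "transpose_mat (first_cols l U) *\<^sub>v x = 0\<^sub>v l \<longleftrightarrow> (\<forall>i<l. col U i \<bullet> x = 0)"
    using F by (auto simp: vec_eq_iff col_first_cols[OF assms])
  thus ?thesis by (simp add: deflated_def)
qed

lemma deflated_carrier: "x \<in> deflated m U l \<Longrightarrow> x \<in> carrier_vec m"
  by (simp add: deflated_def)

lemma mult_mat_zero_vec:
  fixes A :: "'a :: semiring_0 mat"
  assumes "A \<in> carrier_mat nr nc"
  shows "A *\<^sub>v 0\<^sub>v nc = 0\<^sub>v nr"
  using assms by auto

lemma deflated_zero:
  assumes "U \<in> carrier_mat m m" and "l \<le> m"
  shows "0\<^sub>v m \<in> deflated m U l"
  using assms by (auto simp: deflated_iff[OF assms])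

lemma deflated_smult:
  assumes "U \<in> carrier_mat m m" and "l \<le> m" and "x \<in> deflated m U l"
  shows "a \<cdot>\<^sub>v x \<in> deflated m U l"
  using assms(1,3) by (auto simp: deflated_iff[OF assms(1,2)])

lemma deflated_minus:
  assumes "U \<in> carrier_mat m m" and "l \<le> m"
    and "x \<in> deflated m U l" and "y \<in> deflated m U l"
  shows "x - y \<in> deflated m U l"
  using assms(1,3,4)
  by (auto simp: deflated_iff[OF assms(1,2)] scalar_prod_minus_distrib[where n = m])

section \<open>Inverse of a positive definite matrix and the normalization step\<close>

lemma spd_mat_inv:
  assumes "spd_mat n M"
  shows "mat_inv M \<in> carrier_mat n n" and "M * mat_inv M = 1\<^sub>m n" and "mat_inv M * M = 1\<^sub>m n"
proof -
  have M: "M \<in> carrier_mat n n"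
    and pos: "\<And>x. x \<in> carrier_vec n \<Longrightarrow> x \<noteq> 0\<^sub>v n \<Longrightarrow> x \<bullet> (M *\<^sub>v x) > 0"
    using assms by (auto simp: spd_mat_def)
  have "det M \<noteq> 0"
  proof
    assume "det M = 0"
    \<comment> \<open>A nonzero kernel vector \<open>v\<close> would make the quadratic form
      \<open>v \<bullet> (M *\<^sub>v v)\<close> vanish.\<close>
    then obtain v where "v \<in> carrier_vec n" "v \<noteq> 0\<^sub>v n" "M *\<^sub>v v = 0\<^sub>v n"
      using det_0_iff_vec_prod_zero_field[OF M] by blast
    with pos[of v] show False by simp
  qed
  \<comment> \<open>A nonzero determinant makes \<open>M\<close> a unit of the matrix ring, which
    rules out \<open>None\<close>; \<open>()\<close> fills the arbitrary extra parameter of that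
    ring.\<close>
  from det_non_zero_imp_unit[OF M this, of "()"] mat_inverse(1)[OF M, of "()"]
  obtain B where "mat_inverse M = Some B" by blast
  with mat_inverse(2)[OF M this]
  show "mat_inv M \<in> carrier_mat n n" "M * mat_inv M = 1\<^sub>m n" "mat_inv M * M = 1\<^sub>m n"
    by simp_all
qed

text \<open>In \<open>M *\<^sub>v u\<close> the matrix cancels the inverse applied by the
  normalization, which leaves the multiple \<open>1 / \<beta>\<close> of \<open>w\<close>; the space
  is closed under scaling.\<close>

lemma elliptic_normalize_deflated:
  assumes M: "spd_mat m M" and U: "U \<in> carrier_mat m m" "l \<le> m"
    and w: "w \<in> deflated m U l" and eq: "elliptic_normalize M w = Some (\<beta>, u)"
  shows "u \<in> carrier_vec m \<and> M *\<^sub>v u \<in> deflated m U l"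
proof -
  note inv = spd_mat_inv[OF M]
  have Mc: "M \<in> carrier_mat m m" using M by (simp add: spd_mat_def)
  have wc: "w \<in> carrier_vec m" using w by (rule deflated_carrier)
  have u: "u = (1 / \<beta>) \<cdot>\<^sub>v (mat_inv M *\<^sub>v w)"
    using eq by (auto simp: elliptic_normalize_def Let_def split: if_splits)
  have iw: "mat_inv M *\<^sub>v w \<in> carrier_vec m" using inv(1) wc by simp
  have "M *\<^sub>v u = (1 / \<beta>) \<cdot>\<^sub>v (M *\<^sub>v (mat_inv M *\<^sub>v w))"
    unfolding u using Mc iw by (rule mult_mat_vec)
  also have "M *\<^sub>v (mat_inv M *\<^sub>v w) = w"
    using assoc_mult_mat_vec[OF Mc inv(1) wc] inv(2) wc by simp
  finally show ?thesis
    using deflated_smult[OF U w, of "1 / \<beta>"] u iw by simp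
qed

section \<open>The ESVD and its action on deflated vectors\<close>

lemma is_esvd_carrier:
  assumes "is_esvd m n M N A U S V"
  shows "U \<in> carrier_mat m m" and "S \<in> carrier_mat m n" and "V \<in> carrier_mat n n"
  using assms by (auto simp: is_esvd_def)

text \<open>Nested to the right, the product can be transposed or applied to a vector by peeling off
  one factor at a time.\<close>

lemma is_esvd_assoc:
  assumes M: "spd_mat m M" and N: "spd_mat n N" and svd: "is_esvd m n M N A U S V"
  shows "A = M * (U * (S * (transpose_mat V * N)))"
proof -
  note c = is_esvd_carrier[OF svd]
  have "M \<in> carrier_mat m m" "N \<in> carrier_mat n n" using M N by (auto simp: spd_mat_def)
  moreover have "A = M * U * S * transpose_mat V * N" using svd by (simp add: is_esvd_def)
  ultimately show ?thesis
    using c by (simp add: assoc_mult_mat[of _ m m _ n _ n] assoc_mult_mat[of _ m n _ n _ n])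
qed

text \<open>Transposition reverses the product and fixes the symmetric \<open>M\<close> and
  \<open>N\<close>. This duality turns each result on \<open>A\<close> and the \<open>v\<close>
  vectors into one on the transpose and the \<open>u\<close> vectors.\<close>

lemma is_esvd_transpose:
  assumes M: "spd_mat m M" and N: "spd_mat n N" and svd: "is_esvd m n M N A U S V"
  shows "is_esvd n m N M (transpose_mat A) V (transpose_mat S) U"
proof -
  have Mc: "M \<in> carrier_mat m m" "transpose_mat M = M"
    and Nc: "N \<in> carrier_mat n n" "transpose_mat N = N"
    using M N by (auto simp: spd_mat_def)
  note c = is_esvd_carrier[OF svd]
  have "transpose_mat A = transpose_mat (M * (U * (S * (transpose_mat V * N))))"
    by (simp only: is_esvd_assoc[OF M N svd, symmetric])
  also have "\<dots> = N * V * transpose_mat S * transpose_mat U * M"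
    using Mc Nc c
    by (simp add: transpose_mult[of _ m m _ n] transpose_mult[of _ m n _ n]
        transpose_mult[of _ n n _ n] del: assoc_mult_mat)
  finally have A: "transpose_mat A = N * V * transpose_mat S * transpose_mat U * M" .
  have "diagonal_mat (transpose_mat S)"
    using svd by (auto simp: is_esvd_def diagonal_mat_def)
  moreover have "transpose_mat S $$ (i, i) = S $$ (i, i)" if "i < min n m" for i
    using that c by simp
  moreover have "transpose_mat U * M * U = 1\<^sub>m m" "transpose_mat V * N * V = 1\<^sub>m n"
    "\<And>i. i < min n m \<Longrightarrow> S $$ (i, i) \<ge> 0"
    "\<And>i j. i \<le> j \<Longrightarrow> j < min n m \<Longrightarrow> S $$ (j, j) \<le> S $$ (i, i)"
    using svd unfolding is_esvd_def min.commute[of n m] by blast+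
  ultimately show ?thesis
    unfolding is_esvd_def using A c by (intro conjI allI impI) simp_all
qed

text \<open>The first \<open>l\<close> coordinates of \<open>v\<close> in the basis of columns of
  \<open>V\<close> vanish. The diagonal \<open>S\<close> keeps them zero, and pairing with the
  columns of \<open>U\<close> reads them off from \<open>A *\<^sub>v v\<close>.\<close>

lemma esvd_mult_deflated:
  assumes M: "spd_mat m M" and N: "spd_mat n N" and svd: "is_esvd m n M N A U S V"
    and l: "l \<le> min m n" and v: "v \<in> carrier_vec n" and Nv: "N *\<^sub>v v \<in> deflated n V l"
  shows "A *\<^sub>v v \<in> deflated m U l"
proof -
  have Mc: "M \<in> carrier_mat m m" and Nc: "N \<in> carrier_mat n n"
    using M N by (auto simp: spd_mat_def)
  note c = is_esvd_carrier[OF svd]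
  have UMU: "transpose_mat U * M * U = 1\<^sub>m m"
    and diag: "diagonal_mat S" using svd by (auto simp: is_esvd_def)
  have lm: "l \<le> m" and ln: "l \<le> n" using l by auto
  \<comment> \<open>As \<open>V\<close> is square and \<open>N\<close>-orthonormal, \<open>z\<close>
    is the coordinate vector of \<open>v\<close> with respect to its columns.\<close>
  define z where "z = transpose_mat V *\<^sub>v (N *\<^sub>v v)"
  have zc: "z \<in> carrier_vec n" using c Nc v by (simp add: z_def)
  have z0: "z $ i = 0" if "i < l" for i
    using Nv that ln c by (simp add: deflated_iff[OF c(3) ln] z_def)
  have Av: "A *\<^sub>v v = M *\<^sub>v (U *\<^sub>v (S *\<^sub>v z))"
    unfolding is_esvd_assoc[OF M N svd] z_def using Mc Nc c v
    by (simp add: assoc_mult_mat_vec[of _ m m _ n] assoc_mult_mat_vec[of _ m n _ n]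
        assoc_mult_mat_vec[of _ n n _ n])
  have Sz: "S *\<^sub>v z \<in> carrier_vec m" using c zc by simp
  have UA: "transpose_mat U *\<^sub>v (A *\<^sub>v v) = S *\<^sub>v z"
  proof -
    have "transpose_mat U *\<^sub>v (A *\<^sub>v v) = (transpose_mat U * M * U) *\<^sub>v (S *\<^sub>v z)"
      unfolding Av using Mc c Sz by (simp add: assoc_mult_mat_vec[of _ m m _ m])
    thus ?thesis using UMU Sz by simp
  qed
  have "col U i \<bullet> (A *\<^sub>v v) = 0" if i: "i < l" for i
  proof -
    have "col U i \<bullet> (A *\<^sub>v v) = (transpose_mat U *\<^sub>v (A *\<^sub>v v)) $ i"
      using i lm c by simp
    also have "\<dots> = (\<Sum>j<n. S $$ (i, j) * z $ j)"
      unfolding UA using i lm c zc by (simp add: scalar_prod_def lessThan_atLeast0)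
    also have "\<dots> = 0"
    \<comment> \<open>Off the diagonal the entry of \<open>S\<close> is zero; for
      \<open>j = i\<close> the factor \<open>z $ i\<close> is zero because
      \<open>i < l\<close>.\<close>
    proof (rule sum.neutral, safe)
      fix j assume "j < n"
      thus "S $$ (i, j) * z $ j = 0"
        using z0[OF i] diag i lm c by (cases "i = j") (auto simp: diagonal_mat_def)
    qed
    finally show ?thesis .
  qed
  moreover have "A *\<^sub>v v \<in> carrier_vec m" unfolding Av using Mc c Sz by simp
  ultimately show ?thesis by (simp add: deflated_iff[OF c(1) lm])
qed

section \<open>The oblique projector and its range\<close>

lemma transpose_deflation_Q:
  assumes N: "spd_mat n N" and V: "V \<in> carrier_mat n n" "l \<le> n"
  shows "transpose_mat (deflation_Q N V l) = deflation_P N V l"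
proof -
  have Nc: "N \<in> carrier_mat n n" "transpose_mat N = N" using N by (auto simp: spd_mat_def)
  note F = first_cols_carrier[OF V]
  have "transpose_mat (deflation_Q N V l) =
      1\<^sub>m n - transpose_mat (first_cols l V * transpose_mat (first_cols l V) * N)"
    unfolding deflation_Q_def using Nc F by (subst transpose_minus[of _ n n]) auto
  also have "transpose_mat (first_cols l V * transpose_mat (first_cols l V) * N) =
      N * first_cols l V * transpose_mat (first_cols l V)"
    using Nc F
    by (simp add: transpose_mult[of _ n l _ n] transpose_mult[of _ l n _ n]
        assoc_mult_mat[of _ n l _ n _ n])
  finally show ?thesis using Nc by (simp add: deflation_P_def)
qed

lemma deflation_P_carrier:
  assumes M: "M \<in> carrier_mat m m" and U: "U \<in> carrier_mat m m" "l \<le> m"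
  shows "deflation_P M U l \<in> carrier_mat m m"
proof -
  note F = first_cols_carrier[OF U]
  have "M * first_cols l U * transpose_mat (first_cols l U) \<in> carrier_mat m m"
    using M F by (intro mult_carrier_mat[of _ m l] mult_carrier_mat[of _ m m]) auto
  thus ?thesis using M by (simp add: deflation_P_def minus_carrier_mat)
qed

lemma deflation_P_mult_vec:
  assumes M: "M \<in> carrier_mat m m" and U: "U \<in> carrier_mat m m" "l \<le> m"
    and x: "x \<in> carrier_vec m"
  shows "deflation_P M U l *\<^sub>v x =
    x - M *\<^sub>v (first_cols l U *\<^sub>v (transpose_mat (first_cols l U) *\<^sub>v x))"
proof -
  note F = first_cols_carrier[OF U]
  show ?thesis
    unfolding deflation_P_def using M F x
    by (simp add: minus_mult_distrib_mat_vec[of _ m m] assoc_mult_mat_vec[of _ m m _ m]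
        assoc_mult_mat_vec[of _ m l _ m])
qed

text \<open>This is the leading \<open>l\<close> by \<open>l\<close> block of the identity for
  \<open>U\<close>.\<close>

lemma first_cols_orthonormal:
  assumes M: "M \<in> carrier_mat m m" and U: "U \<in> carrier_mat m m" "l \<le> m"
    and UMU: "transpose_mat U * M * U = 1\<^sub>m m"
  shows "transpose_mat (first_cols l U) * (M * first_cols l U) = 1\<^sub>m l"
proof (rule eq_matI)
  note F = first_cols_carrier[OF U]
  fix i j assume ij: "i < dim_row (1\<^sub>m l :: real mat)" "j < dim_col (1\<^sub>m l :: real mat)"
  have "(transpose_mat (first_cols l U) * (M * first_cols l U)) $$ (i, j) =
      col U i \<bullet> (M *\<^sub>v col U j)"
    using ij F M U(2) by (simp add: col_first_cols[OF U] mult_mat_vec_def)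
  also have "\<dots> = (transpose_mat U * (M * U)) $$ (i, j)"
    using ij M U by (simp add: mult_mat_vec_def)
  also have "\<dots> = (1\<^sub>m l) $$ (i, j)"
    using UMU ij M U by (simp add: assoc_mult_mat[of _ m m _ m _ m])
  finally show "(transpose_mat (first_cols l U) * (M * first_cols l U)) $$ (i, j) = 1\<^sub>m l $$ (i, j)" .
qed (use first_cols_carrier[OF U] in auto)

text \<open>Applied to the subtracted part of the projection, the transposed first columns give
  \<open>y\<close> again by orthonormality, so the two contributions cancel.\<close>

lemma deflation_P_deflated:
  assumes M: "M \<in> carrier_mat m m" and U: "U \<in> carrier_mat m m" "l \<le> m"
    and UMU: "transpose_mat U * M * U = 1\<^sub>m m" and x: "x \<in> carrier_vec m"
  shows "deflation_P M U l *\<^sub>v x \<in> deflated m U l"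
proof -
  note F = first_cols_carrier[OF U]
  define y where "y = transpose_mat (first_cols l U) *\<^sub>v x"
  have y: "y \<in> carrier_vec l" using F x by (simp add: y_def)
  have "transpose_mat (first_cols l U) *\<^sub>v (M *\<^sub>v (first_cols l U *\<^sub>v y)) =
      (transpose_mat (first_cols l U) * (M * first_cols l U)) *\<^sub>v y"
    using F M y by (simp add: assoc_mult_mat_vec[of _ l m _ l] assoc_mult_mat_vec[of _ m m _ l])
  also have "\<dots> = y" using first_cols_orthonormal[OF M U UMU] y by simp
  finally have "transpose_mat (first_cols l U) *\<^sub>v (deflation_P M U l *\<^sub>v x) = y - y"
    using F M x y
    by (simp add: deflation_P_mult_vec[OF M U x] y_def[symmetric]
        mult_minus_distrib_mat_vec[of _ l m])
  thus ?thesis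
    using deflation_P_carrier[OF M U] x y by (simp add: deflated_def)
qed

text \<open>The projector fixes each such vector, as its correction term is zero; so the vector is
  its own preimage.\<close>

lemma deflated_subset_col_space:
  assumes M: "M \<in> carrier_mat m m" and U: "U \<in> carrier_mat m m" "l \<le> m"
  shows "deflated m U l \<subseteq> vec_space.col_space m (deflation_P M U l)"
proof
  note F = first_cols_carrier[OF U] and P = deflation_P_carrier[OF M U]
  fix x assume x: "x \<in> deflated m U l"
  hence xc: "x \<in> carrier_vec m" and "transpose_mat (first_cols l U) *\<^sub>v x = 0\<^sub>v l"
    by (auto simp: deflated_def)
  moreover have "M *\<^sub>v (first_cols l U *\<^sub>v 0\<^sub>v l) = 0\<^sub>v m"
    by (simp add: mult_mat_zero_vec[OF F] mult_mat_zero_vec[OF M])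
  ultimately have "deflation_P M U l *\<^sub>v x = x"
    by (simp add: deflation_P_mult_vec[OF M U xc])
  thus "x \<in> vec_space.col_space m (deflation_P M U l)"
    using xc P by (auto simp: vec_space.col_space_eq[OF P])
qed

text \<open>Passes from the individual columns to all their linear combinations: \<open>M\<close>
  maps each combination \<open>y\<close> into the range of the projector, and the inverse of
  \<open>M\<close> recovers \<open>y\<close>.\<close>

lemma col_space_subset_inv_image:
  assumes M: "spd_mat m M" and U: "U \<in> carrier_mat m m" "l \<le> m"
    and us: "\<And>u. u \<in> set us \<Longrightarrow> u \<in> carrier_vec m \<and> M *\<^sub>v u \<in> deflated m U l"
  shows "vec_space.col_space m (mat_of_cols m us) \<subseteq>
    (\<lambda>s. mat_inv M *\<^sub>v s) ` vec_space.col_space m (deflation_P M U l)"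
proof
  have Mc: "M \<in> carrier_mat m m" using M by (simp add: spd_mat_def)
  note F = first_cols_carrier[OF U] and inv = spd_mat_inv[OF M]
  define k where "k = length us"
  define G where "G = mat_of_cols m us"
  have G: "G \<in> carrier_mat m k" by (simp add: G_def k_def)
  have colG: "col G j \<in> carrier_vec m \<and> M *\<^sub>v col G j \<in> deflated m U l" if "j < k" for j
    using us[OF nth_mem, of j] that by (simp add: G_def k_def)
  \<comment> \<open>Entry \<open>(i, j)\<close> pairs column \<open>i\<close> of \<open>U\<close>
    with \<open>M\<close> times column \<open>j\<close> of \<open>G\<close>, so orthogonality of all
    columns becomes one matrix equation.\<close>
  have "transpose_mat (first_cols l U) * (M * G) = 0\<^sub>m l k"
  proof (rule eq_matI)
    fix i j assume ij: "i < dim_row (0\<^sub>m l k :: real mat)" "j < dim_col (0\<^sub>m l k :: real mat)"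
    thus "(transpose_mat (first_cols l U) * (M * G)) $$ (i, j) = 0\<^sub>m l k $$ (i, j)"
      using colG[of j] F Mc G
      by (simp add: col_first_cols[OF U] deflated_iff[OF U] mult_mat_vec_def)
  qed (use F Mc G in auto)
  note FMG = this
  fix y assume "y \<in> vec_space.col_space m (mat_of_cols m us)"
  then obtain x where x: "x \<in> carrier_vec k" and y: "y = G *\<^sub>v x"
    using G unfolding G_def[symmetric] by (auto simp: vec_space.col_space_eq[OF G])
  have yc: "y \<in> carrier_vec m" using G x y by simp
  have "transpose_mat (first_cols l U) *\<^sub>v (M *\<^sub>v y) =
      (transpose_mat (first_cols l U) * (M * G)) *\<^sub>v x"
    unfolding y using F Mc G x
    by (simp add: assoc_mult_mat_vec[of _ l m _ k] assoc_mult_mat_vec[of _ m m _ k])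
  hence "M *\<^sub>v y \<in> deflated m U l"
    using FMG x Mc yc by (auto simp: deflated_def)
  hence "M *\<^sub>v y \<in> vec_space.col_space m (deflation_P M U l)"
    using deflated_subset_col_space[OF Mc U] by blast
  moreover have "y = mat_inv M *\<^sub>v (M *\<^sub>v y)"
    using assoc_mult_mat_vec[OF inv(1) Mc yc] inv(3) yc by simp
  ultimately show "y \<in> (\<lambda>s. mat_inv M *\<^sub>v s) ` vec_space.col_space m (deflation_P M U l)"
    by (rule rev_image_eqI)
qed

section \<open>Invariance along the recurrence\<close>

lemma gssy_deflated:
  assumes M: "spd_mat m M" and N: "spd_mat n N" and svd: "is_esvd m n M N A U S V"
    and l: "l \<le> min m n" and b: "b \<in> deflated m U l" and c: "c \<in> deflated n V l"
    and "gssy M N A b c k = Some s"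
  shows "u_prev s \<in> carrier_vec m \<and> M *\<^sub>v u_prev s \<in> deflated m U l
    \<and> u_cur s \<in> carrier_vec m \<and> M *\<^sub>v u_cur s \<in> deflated m U l
    \<and> v_prev s \<in> carrier_vec n \<and> N *\<^sub>v v_prev s \<in> deflated n V l
    \<and> v_cur s \<in> carrier_vec n \<and> N *\<^sub>v v_cur s \<in> deflated n V l"
  using assms(7)
\<comment> \<open>The previous vectors must be part of the invariant because the three-term
  recurrence uses them; at the start they are zero.\<close>
proof (induction k arbitrary: s)
  case 0
  have lm: "l \<le> m" and ln: "l \<le> n" using l by auto
  have Mc: "M \<in> carrier_mat m m" and Nc: "N \<in> carrier_mat n n"
    using M N by (auto simp: spd_mat_def)
  note cs = is_esvd_carrier[OF svd]
  from 0 obtain \<beta> u \<gamma> v where eqs: "elliptic_normalize M b = Some (\<beta>, u)"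
      "elliptic_normalize N c = Some (\<gamma>, v)"
    and s: "s = \<lparr>beta = \<beta>, u_prev = 0\<^sub>v m, u_cur = u, gamma = \<gamma>, v_prev = 0\<^sub>v n, v_cur = v\<rparr>"
    using Mc Nc by (auto simp: gssy_init_def split: option.splits)
  show ?case
    using elliptic_normalize_deflated[OF M cs(1) lm b eqs(1)]
      elliptic_normalize_deflated[OF N cs(3) ln c eqs(2)]
      deflated_zero[OF cs(1) lm] deflated_zero[OF cs(3) ln]
    by (simp add: s mult_mat_zero_vec[OF Mc] mult_mat_zero_vec[OF Nc])
next
  case (Suc k)
  have lm: "l \<le> m" and ln: "l \<le> n" and l': "l \<le> min n m" using l by auto
  note cs = is_esvd_carrier[OF svd]
  from Suc.prems obtain t where t: "gssy M N A b c k = Some t" and step: "gssy_step M N A t = Some s"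
    by (auto simp: bind_eq_Some_conv)
  note IH = Suc.IH[OF t]
  define q where "q = A *\<^sub>v v_cur t - gamma t \<cdot>\<^sub>v (M *\<^sub>v u_prev t)"
  define p where "p = transpose_mat A *\<^sub>v u_cur t - beta t \<cdot>\<^sub>v (N *\<^sub>v v_prev t)"
  define \<alpha> where "\<alpha> = u_cur t \<bullet> q"
  \<comment> \<open>All three terms lie in the space: \<open>A *\<^sub>v v_cur t\<close> by the
    ESVD, the two multiples of \<open>M\<close> images by the induction hypothesis.\<close>
  have q: "q - \<alpha> \<cdot>\<^sub>v (M *\<^sub>v u_cur t) \<in> deflated m U l"
    unfolding q_def using IH
    by (intro deflated_minus[OF cs(1) lm] deflated_smult[OF cs(1) lm]
        esvd_mult_deflated[OF M N svd l]) auto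
  \<comment> \<open>The same argument with the ESVD of the transpose, which swaps the roles of
    \<open>m\<close> and \<open>n\<close>.\<close>
  have p: "p - \<alpha> \<cdot>\<^sub>v (N *\<^sub>v v_cur t) \<in> deflated n V l"
    unfolding p_def using IH
    by (intro deflated_minus[OF cs(3) ln] deflated_smult[OF cs(3) ln]
        esvd_mult_deflated[OF N M is_esvd_transpose[OF M N svd] l']) auto
  from step obtain \<beta> u \<gamma> v
    where eqs: "elliptic_normalize M (q - \<alpha> \<cdot>\<^sub>v (M *\<^sub>v u_cur t)) = Some (\<beta>, u)"
      "elliptic_normalize N (p - \<alpha> \<cdot>\<^sub>v (N *\<^sub>v v_cur t)) = Some (\<gamma>, v)"
    and s: "s = \<lparr>beta = \<beta>, u_prev = u_cur t, u_cur = u, gamma = \<gamma>, v_prev = v_cur t, v_cur = v\<rparr>"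
    unfolding q_def p_def \<alpha>_def by (auto simp: gssy_step_def Let_def split: option.splits)
  show ?case
    using elliptic_normalize_deflated[OF M cs(1) lm q eqs(1)]
      elliptic_normalize_deflated[OF N cs(3) ln p eqs(2)] IH
    by (simp add: s)
qed

text \<open>\<open>Option.bind\<close> passes \<open>None\<close> on, so termination at an earlier
  state would persist; the induction descends from \<open>k\<close> to \<open>i\<close>.\<close>

lemma gssy_defined_before:
  assumes "gssy M N A b c k \<noteq> None" and "i \<le> k"
  shows "gssy M N A b c i \<noteq> None"
  using assms(2,1) by (induction rule: inc_induct) (auto simp: bind_eq_Some_conv)

theorem theorem3:
  fixes m n l k :: nat
    and M N A U S V P Q :: "real mat"
    and b c :: "real vec"
  assumes "spd_mat m M" and "spd_mat n N"
    and "A \<in> carrier_mat m n" and "A \<noteq> 0\<^sub>m m n"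
    and "b \<in> carrier_vec m" and "b \<noteq> 0\<^sub>v m"
    and "c \<in> carrier_vec n" and "c \<noteq> 0\<^sub>v n"
    and "is_esvd m n M N A U S V"
    and "1 \<le> l" and "l \<le> min m n"
    and "P = deflation_P M U l"
    and "Q = deflation_Q N V l"
    and "gssy M N A (P *\<^sub>v b) (transpose_mat Q *\<^sub>v c) k \<noteq> None"
  shows "vec_space.col_space m (gssy_U M N A (P *\<^sub>v b) (transpose_mat Q *\<^sub>v c) (k + 1))
           \<subseteq> (\<lambda>s. mat_inv M *\<^sub>v s) ` vec_space.col_space m P
       \<and> vec_space.col_space n (gssy_V M N A (P *\<^sub>v b) (transpose_mat Q *\<^sub>v c) (k + 1))
           \<subseteq> (\<lambda>s. mat_inv N *\<^sub>v s) ` vec_space.col_space n (transpose_mat Q)"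
proof -
  have Mc: "M \<in> carrier_mat m m" and Nc: "N \<in> carrier_mat n n"
    using assms(1,2) by (auto simp: spd_mat_def)
  note cs = is_esvd_carrier[OF assms(9)]
  have lm: "l \<le> m" and ln: "l \<le> n" using assms(11) by auto
  have UMU: "transpose_mat U * M * U = 1\<^sub>m m" and VNV: "transpose_mat V * N * V = 1\<^sub>m n"
    using assms(9) by (auto simp: is_esvd_def)
  have QT: "transpose_mat Q = deflation_P N V l"
    unfolding assms(13) using assms(2) cs(3) ln by (rule transpose_deflation_Q)
  have Pb: "P *\<^sub>v b \<in> deflated m U l"
    unfolding assms(12) by (rule deflation_P_deflated[OF Mc cs(1) lm UMU assms(5)])
  have Qc: "transpose_mat Q *\<^sub>v c \<in> deflated n V l"
    unfolding QT by (rule deflation_P_deflated[OF Nc cs(3) ln VNV assms(7)])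
  \<comment> \<open>The states up to \<open>k\<close> are all defined, so \<open>the\<close> returns
    genuine states here.\<close>
  define st where "st = (\<lambda>i. the (gssy M N A (P *\<^sub>v b) (transpose_mat Q *\<^sub>v c) i))"
  have "gssy M N A (P *\<^sub>v b) (transpose_mat Q *\<^sub>v c) i = Some (st i)" if "i \<le> k" for i
    using gssy_defined_before[OF assms(14) that] by (auto simp: st_def)
  note inv = gssy_deflated[OF assms(1,2,9,11) Pb Qc this]
  \<comment> \<open>State \<open>i\<close> carries the vector with index \<open>i + 1\<close>; hence
    the indices \<open>0\<close> to \<open>k\<close> yield u_1, ..., u_(k+1).\<close>
  have "vec_space.col_space m (mat_of_cols m (map (\<lambda>i. u_cur (st i)) [0..<k + 1]))
      \<subseteq> (\<lambda>s. mat_inv M *\<^sub>v s) ` vec_space.col_space m (deflation_P M U l)"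
    by (rule col_space_subset_inv_image[OF assms(1) cs(1) lm]) (use inv in auto)
  moreover have "vec_space.col_space n (mat_of_cols n (map (\<lambda>i. v_cur (st i)) [0..<k + 1]))
      \<subseteq> (\<lambda>s. mat_inv N *\<^sub>v s) ` vec_space.col_space n (deflation_P N V l)"
    by (rule col_space_subset_inv_image[OF assms(2) cs(3) ln]) (use inv in auto)
  ultimately show ?thesis
    using Mc Nc unfolding gssy_U_def gssy_V_def st_def QT assms(12) by simp
qed

end
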